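(* Let $G$ be a finite cyclic group, and let $A$ be a $G$-module. Suppose there exists a $G$-submodule $B$ of finite index in $A$ which is a finitely generated free abelian group having a $G$-invariant $\mathbb{Z}$-basis $X=\{x_1,\dots,x_r\}$ (i.e. $\tau X\subset X$ for all $\tau\in G$, so that $X$ is a $G$-set). Then $$h(G,A)=\prod_{x\in X/G}\sharp G_x,\qquad\text{and}\qquad \sharp \mathrm{H}^1(G,A)=\frac{(A^G:N_GA)}{\prod_{x\in X/G}\sharp G_x},$$ where $G_x=\{\tau\in G:\ \tau x=x\}$ is the stabilizer of $x$.
   Context: $\sharp S$ denotes the cardinality of a set $S$. $A^G$ is the subgroup of $G$-invariant elements of $A$, $N_G=\sum_{\tau\in G}\tau\in\mathbb{Z}[G]$, and $N_GA=\{N_G a: a\in A\}$. $\widehat{\mathrm{H}}^0(G,A)=A^G/N_GA$ is the Tate cohomology group in degree $0$, $\mathrm{H}^1(G,A)$ is the usual first cohomology group, and the Herbrand quotient is $h(G,A)=\sharp\widehat{\mathrm{H}}^0(G,A)/\sharp\mathrm{H}^1(G,A)$. $X/G$ denotes the set of $G$-orbits of $X$; a product over $x\in X/G$ means that $x$ runs over a set of representatives, one from each orbit. *)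

theory Defs
  imports "HOL-Algebra.Group_Action" "HOL-Algebra.Product_Groups" "HOL-Algebra.FiniteProduct"
begin

text \<open>
  The underlying abelian group of a \<open>G\<close>-module is a \<open>comm_group\<close>, hence written multiplicatively:
  \<open>a + b\<close> becomes \<open>a \<otimes> b\<close>, and \<open>n a\<close> becomes \<open>a [^] n\<close>.
  The action of \<open>\<sigma>\<close> on \<open>a\<close> is \<open>\<phi> \<sigma> a\<close>.
\<close>

locale G_module = group_action G "carrier A" \<phi> + A: comm_group A
  for G :: "('g, 'm) monoid_scheme" and A :: "('a, 'n) monoid_scheme" and \<phi> +
  assumes action_hom: "\<sigma> \<in> carrier G \<Longrightarrow> \<phi> \<sigma> \<in> hom A A"

definition G_submodule ::
    "('g, 'm) monoid_scheme \<Rightarrow> ('a, 'n) monoid_scheme \<Rightarrow> ('g \<Rightarrow> 'a \<Rightarrow> 'a) \<Rightarrow> 'a set \<Rightarrow> bool"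
  where "G_submodule G A \<phi> B \<longleftrightarrow> subgroup B A \<and> (\<forall>\<sigma>\<in>carrier G. \<phi> \<sigma> ` B \<subseteq> B)"

text \<open>The finite set \<open>S\<close> is a \<open>\<int>\<close>-basis of the subgroup \<open>B\<close> of \<open>A\<close>.\<close>

definition finite_Z_basis :: "('a, 'n) monoid_scheme \<Rightarrow> 'a set \<Rightarrow> 'a set \<Rightarrow> bool"
  where "finite_Z_basis A B S \<longleftrightarrow>
    finite S \<and> S \<subseteq> carrier A \<and> generate A S = B \<and>
    (\<forall>c :: 'a \<Rightarrow> int. (\<Otimes>\<^bsub>A\<^esub>x\<in>S. x [^]\<^bsub>A\<^esub> c x) = \<one>\<^bsub>A\<^esub> \<longrightarrow> (\<forall>x\<in>S. c x = 0))"

definition fixed_points ::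
    "('g, 'm) monoid_scheme \<Rightarrow> ('a, 'n) monoid_scheme \<Rightarrow> ('g \<Rightarrow> 'a \<Rightarrow> 'a) \<Rightarrow> 'a set"
  where "fixed_points G A \<phi> = {a \<in> carrier A. \<forall>\<sigma>\<in>carrier G. \<phi> \<sigma> a = a}"

definition norm_map ::
    "('g, 'm) monoid_scheme \<Rightarrow> ('a, 'n) monoid_scheme \<Rightarrow> ('g \<Rightarrow> 'a \<Rightarrow> 'a) \<Rightarrow> 'a \<Rightarrow> 'a"
  where "norm_map G A \<phi> a = (\<Otimes>\<^bsub>A\<^esub>\<tau>\<in>carrier G. \<phi> \<tau> a)"

definition norm_image ::
    "('g, 'm) monoid_scheme \<Rightarrow> ('a, 'n) monoid_scheme \<Rightarrow> ('g \<Rightarrow> 'a \<Rightarrow> 'a) \<Rightarrow> 'a set"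
  where "norm_image G A \<phi> = norm_map G A \<phi> ` carrier A"

definition Tate_H0 ::
    "('g, 'm) monoid_scheme \<Rightarrow> ('a, 'n) monoid_scheme \<Rightarrow> ('g \<Rightarrow> 'a \<Rightarrow> 'a) \<Rightarrow> 'a set monoid"
  where "Tate_H0 G A \<phi> =
    A\<lparr>carrier := fixed_points G A \<phi>\<rparr> Mod norm_image G A \<phi>"

text \<open>\<open>H\<^sup>1\<close> is the group of crossed homomorphisms \<open>G \<rightarrow> A\<close> (under pointwise multiplication)
  modulo the principal ones.\<close>

definition cocycles1 ::
    "('g, 'm) monoid_scheme \<Rightarrow> ('a, 'n) monoid_scheme \<Rightarrow> ('g \<Rightarrow> 'a \<Rightarrow> 'a) \<Rightarrow> ('g \<Rightarrow> 'a) set"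
  where "cocycles1 G A \<phi> =
    {f \<in> carrier G \<rightarrow>\<^sub>E carrier A.
       \<forall>\<sigma>\<in>carrier G. \<forall>\<tau>\<in>carrier G. f (\<sigma> \<otimes>\<^bsub>G\<^esub> \<tau>) = f \<sigma> \<otimes>\<^bsub>A\<^esub> \<phi> \<sigma> (f \<tau>)}"

definition coboundaries1 ::
    "('g, 'm) monoid_scheme \<Rightarrow> ('a, 'n) monoid_scheme \<Rightarrow> ('g \<Rightarrow> 'a \<Rightarrow> 'a) \<Rightarrow> ('g \<Rightarrow> 'a) set"
  where "coboundaries1 G A \<phi> =
    {\<lambda>\<sigma>\<in>carrier G. \<phi> \<sigma> a \<otimes>\<^bsub>A\<^esub> inv\<^bsub>A\<^esub> a | a. a \<in> carrier A}"

definition H1 ::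
    "('g, 'm) monoid_scheme \<Rightarrow> ('a, 'n) monoid_scheme \<Rightarrow> ('g \<Rightarrow> 'a \<Rightarrow> 'a) \<Rightarrow> ('g \<Rightarrow> 'a) set monoid"
  where "H1 G A \<phi> =
    (product_group (carrier G) (\<lambda>_. A))\<lparr>carrier := cocycles1 G A \<phi>\<rparr> Mod coboundaries1 G A \<phi>"

text \<open>If one of the two groups is infinite, then \<open>order\<close> is \<open>0\<close> and so is this quotient; hence a
  nonzero value implies that both are finite.\<close>

definition herbrand_quotient ::
    "('g, 'm) monoid_scheme \<Rightarrow> ('a, 'n) monoid_scheme \<Rightarrow> ('g \<Rightarrow> 'a \<Rightarrow> 'a) \<Rightarrow> rat"
  where "herbrand_quotient G A \<phi> =
    of_nat (order (Tate_H0 G A \<phi>)) / of_nat (order (H1 G A \<phi>))"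

end

theory Submission
  imports Defs "HOL-Algebra.Multiplicative_Group"
begin

text \<open>
  Let \<open>\<sigma>\<close> generate the cyclic group \<open>G\<close> of order \<open>n\<close>. Evaluating a crossed homomorphism at \<open>\<sigma>\<close>
  identifies \<open>H\<^sup>1\<close> with the kernel of the norm modulo the image of \<open>\<sigma> - 1\<close> (\<open>order_H1\<close>), while
  the Tate group in degree \<open>0\<close> is the kernel of \<open>\<sigma> - 1\<close> modulo the image of the norm. The Herbrand
  quotient is thus attached to two endomorphisms of \<open>A\<close> whose composites in both orders are
  trivial, and such a quotient does not change on passing to a stable subgroup of finite index. This
  follows from the multiplicativity of indices and from the formula
  \<open>(A : B) = (f A : f B) (ker f : ker f \<inter> B)\<close> (\<open>herbrand_quotient_finite_index\<close>).

  It remains to treat the permutation module \<open>B\<close>, whose elements are integral combinations of the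
  basis \<open>S\<close>. Such an element is fixed when its coefficients are constant on orbits, and the norm of
  \<open>x \<in> S\<close> is the sum of its orbit multiplied by the order of the stabilizer of \<open>x\<close>. So the fixed
  elements modulo norms form the product of the cyclic groups of order \<open>card (stabilizer G \<phi> x)\<close>,
  with \<open>x\<close> running over \<open>R\<close> (\<open>index_norms_in_fixed_points\<close>). An element of trivial norm has
  coefficient sum \<open>0\<close> on every orbit, hence is a combination of differences of two elements of one
  orbit, and these lie in the image of \<open>\<sigma> - 1\<close>; so the other group is trivial
  (\<open>kernel_norm_eq_gen_minus_one_image\<close>). The Herbrand quotient of \<open>B\<close>, and with it that of \<open>A\<close>, is
  the product of the stabilizer orders. The formula for \<open>H\<^sup>1\<close> is this equation solved for its
  denominator.
\<close>

section \<open>Indices of subgroups\<close>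

abbreviation subgroup_index ::
    "('a, 'n) monoid_scheme \<Rightarrow> 'a set \<Rightarrow> 'a set \<Rightarrow> nat"
  where "subgroup_index A H K \<equiv> card (rcosets\<^bsub>A\<lparr>carrier := H\<rparr>\<^esub> K)"

text \<open>
  A map that separates exactly the cosets of \<open>K\<close> in \<open>H\<close> has as many values as there are cosets.
  Indices are computed below by choosing such a map \<open>\<psi>\<close> with a recognizable image.
\<close>

lemma subgroup_index_eq_card_image:
  fixes A (structure)
  assumes "\<And>a b. a \<in> H \<Longrightarrow> b \<in> H \<Longrightarrow> \<psi> a = \<psi> b \<longleftrightarrow> K #> a = K #> b"
  shows "subgroup_index A H K = card (\<psi> ` H)"
proof -
  have cosets: "rcosets\<^bsub>A\<lparr>carrier := H\<rparr>\<^esub> K = (\<lambda>a. K #> a) ` H"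
    by (auto simp: RCOSETS_def r_coset_def)
  have "bij_betw (\<lambda>y. K #> inv_into H \<psi> y) (\<psi> ` H) ((\<lambda>a. K #> a) ` H)"
  proof (rule bij_betw_imageI)
    show "inj_on (\<lambda>y. K #> inv_into H \<psi> y) (\<psi> ` H)"
      by (rule inj_onI) (metis assms f_inv_into_f inv_into_into)
    have "K #> inv_into H \<psi> (\<psi> a) = K #> a" if "a \<in> H" for a
      using assms that by (metis f_inv_into_f imageI inv_into_into)
    then show "(\<lambda>y. K #> inv_into H \<psi> y) ` \<psi> ` H = (\<lambda>a. K #> a) ` H"
      by (auto simp: image_image)
  qed
  then show ?thesis
    unfolding cosets by (simp add: bij_betw_same_card)
qed

lemma (in group) rcos_eq_iff:
  assumes "subgroup K G" "a \<in> carrier G" "b \<in> carrier G"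
  shows "K #> a = K #> b \<longleftrightarrow> a \<otimes> inv b \<in> K"
proof
  assume "K #> a = K #> b"
  then have "a \<in> K #> b" using assms rcos_self by blast
  then obtain k where "k \<in> K" "a = k \<otimes> b" by (auto simp: r_coset_def)
  then show "a \<otimes> inv b \<in> K"
    using assms by (metis inv_solve_right subgroup.mem_carrier)
next
  assume k: "a \<otimes> inv b \<in> K"
  have "a = (a \<otimes> inv b) \<otimes> b"
    using assms by (simp add: m_assoc)
  then have "a \<in> K #> b" using k by (auto simp: r_coset_def)
  then show "K #> a = K #> b" using assms repr_independence by blast
qed

lemma (in group) subgroup_index_eq_card_image_iff:
  assumes "subgroup K G" "H \<subseteq> carrier G"
    and "\<And>a b. a \<in> H \<Longrightarrow> b \<in> H \<Longrightarrow> \<psi> a = \<psi> b \<longleftrightarrow> a \<otimes> inv b \<in> K"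
  shows "subgroup_index G H K = card (\<psi> ` H)"
  by (rule subgroup_index_eq_card_image) (use assms rcos_eq_iff in blast)

lemma (in group_hom) subgroup_kernel_within:
  assumes "subgroup B G"
  shows "subgroup {a \<in> B. h a = \<one>\<^bsub>H\<^esub>} G"
proof -
  interpret B: subgroup B G by fact
  show ?thesis
  proof (rule G.subgroupI)
    show "{a \<in> B. h a = \<one>\<^bsub>H\<^esub>} \<noteq> {}" using B.one_closed hom_one by blast
  qed (use B.subset in auto)
qed

context comm_group
begin

lemma hom_finprod:
  assumes "f \<in> hom G G" "u \<in> I \<rightarrow> carrier G"
  shows "f (\<Otimes>i\<in>I. u i) = (\<Otimes>i\<in>I. f (u i))"
proof -
  interpret f: group_hom G G f by unfold_locales (fact assms)
  show ?thesis
    using assms(2)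
  proof (induction I rule: infinite_finite_induct)
    case (insert i I)
    then have "u \<in> I \<rightarrow> carrier G" "u i \<in> carrier G" "(\<lambda>i. f (u i)) \<in> I \<rightarrow> carrier G"
      by (auto simp: Pi_iff)
    with insert show ?case by simp
  qed simp_all
qed

lemma finprod_in_subgroup:
  assumes "subgroup K G" "u \<in> I \<rightarrow> K"
  shows "(\<Otimes>i\<in>I. u i) \<in> K"
proof -
  interpret K: subgroup K G by fact
  show ?thesis
    using assms(2)
  proof (induction I rule: infinite_finite_induct)
    case (insert i I)
    then have "u \<in> I \<rightarrow> carrier G" "u i \<in> K" "u \<in> I \<rightarrow> K"
      by (auto simp: Pi_iff)
    with insert show ?case by simp
  qed simp_all
qed

lemma subgroup_index_self:
  assumes "subgroup K G"
  shows "subgroup_index G K K = 1"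
proof -
  interpret K: subgroup K G by fact
  have "subgroup_index G K K = card ((\<lambda>_. ()) ` K)"
    by (rule subgroup_index_eq_card_image_iff) (use K.subset in \<open>auto intro: assms\<close>)
  also have "(\<lambda>_. ()) ` K = {()}" by (rule image_constant[OF K.one_closed])
  finally show ?thesis by simp
qed

text \<open>
  A choice of coset representatives of \<open>L\<close> in \<open>H\<close> identifies the cosets of \<open>K\<close> in \<open>H\<close> with pairs
  of a coset of \<open>L\<close> in \<open>H\<close> and a coset of \<open>K\<close> in \<open>L\<close>. A cartesian product with an infinite
  factor is infinite or empty, and cosets always exist; therefore the formula remains true for
  infinite indices, which count as \<open>0\<close>. This is what makes the cancellations in
  \<open>herbrand_quotient_finite_index\<close> possible while only the index of \<open>B\<close> is known to be finite.
\<close>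

lemma subgroup_index_mult:
  assumes "subgroup H G" "subgroup L G" "subgroup K G" "K \<subseteq> L" "L \<subseteq> H"
  shows "subgroup_index G H K = subgroup_index G H L * subgroup_index G L K"
proof -
  interpret H: subgroup H G by fact
  interpret L: subgroup L G by fact
  interpret K: subgroup K G by fact
  define rep where "rep C = (SOME a. a \<in> H \<and> C = L #> a)" for C
  have rep: "rep (L #> a) \<in> H \<and> L #> a = L #> rep (L #> a)" if "a \<in> H" for a
    unfolding rep_def by (rule someI_ex) (use that in blast)
  have repL: "a \<otimes> inv (rep (L #> a)) \<in> L" if "a \<in> H" for a
    using rep[OF that] rcos_eq_iff[OF L.subgroup_axioms, of a "rep (L #> a)"] that by auto
  define \<psi> where "\<psi> a = (L #> a, K #> (a \<otimes> inv (rep (L #> a))))" for a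
  have "subgroup_index G H K = card (\<psi> ` H)"
  proof (rule subgroup_index_eq_card_image_iff)
    fix a b assume ab: "a \<in> H" "b \<in> H"
    have eq: "(a \<otimes> inv c) \<otimes> inv (b \<otimes> inv c) = a \<otimes> inv b" if "c \<in> H" for c
      using ab that by (simp add: inv_mult_group m_assoc inv_solve_left)
        (simp add: m_assoc[symmetric])
    have "\<psi> a = \<psi> b \<longleftrightarrow> L #> a = L #> b
        \<and> K #> (a \<otimes> inv (rep (L #> a))) = K #> (b \<otimes> inv (rep (L #> a)))"
      by (auto simp: \<psi>_def)
    also have "\<dots> \<longleftrightarrow> a \<otimes> inv b \<in> L \<and> a \<otimes> inv b \<in> K"
      using ab rep[OF ab(1)] eq[of "rep (L #> a)"]
      by (simp add: rcos_eq_iff L.subgroup_axioms K.subgroup_axioms)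
    finally show "\<psi> a = \<psi> b \<longleftrightarrow> a \<otimes> inv b \<in> K" using assms by blast
  qed (use assms H.subset in auto)
  also have "\<psi> ` H = ((\<lambda>a. L #> a) ` H) \<times> ((\<lambda>a. K #> a) ` L)"
  proof
    show "\<psi> ` H \<subseteq> ((\<lambda>a. L #> a) ` H) \<times> ((\<lambda>a. K #> a) ` L)"
      using repL by (auto simp: \<psi>_def)
    show "((\<lambda>a. L #> a) ` H) \<times> ((\<lambda>a. K #> a) ` L) \<subseteq> \<psi> ` H"
    proof clarify
      fix a l assume a: "a \<in> H" and l: "l \<in> L"
      let ?r = "rep (L #> a)"
      have r: "?r \<in> H" "L #> a = L #> ?r" using rep[OF a] by auto
      have lr: "l \<otimes> ?r \<in> H" using l r assms by blast
      have "(l \<otimes> ?r) \<otimes> inv ?r = l" using l r by (simp add: m_assoc)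
      moreover from this have "L #> (l \<otimes> ?r) = L #> ?r"
        using lr r l by (subst rcos_eq_iff) (auto simp: L.subgroup_axioms)
      ultimately have "\<psi> (l \<otimes> ?r) = (L #> a, K #> l)"
        using r by (simp add: \<psi>_def)
      then show "(L #> a, K #> l) \<in> \<psi> ` H" using lr by (metis image_eqI)
    qed
  qed
  also have "card \<dots> = subgroup_index G H L * subgroup_index G L K"
    by (simp add: card_cartesian_product subgroup_index_eq_card_image[where \<psi>="\<lambda>a. L #> a"]
        subgroup_index_eq_card_image[where \<psi>="\<lambda>a. K #> a"])
  finally show ?thesis .
qed

text \<open>
  The preimage of \<open>f B\<close>, which is \<open>B (ker f)\<close>, lies between \<open>B\<close> and the whole group. The upper step of
  this chain has index \<open>(im f : f B)\<close>, the lower one \<open>(ker f : ker f \<inter> B)\<close> by the second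
  isomorphism theorem.
\<close>

lemma subgroup_index_image_kernel:
  assumes f: "f \<in> hom G G" and B: "subgroup B G"
  shows "card (rcosets B) =
    subgroup_index G (f ` carrier G) (f ` B) *
    subgroup_index G {a \<in> carrier G. f a = \<one>} {a \<in> B. f a = \<one>}"
proof -
  interpret f: group_hom G G f by unfold_locales (fact f)
  interpret B: subgroup B G by fact
  let ?Z = "{a \<in> carrier G. f a = \<one>}"
  let ?L = "{a \<in> carrier G. f a \<in> f ` B}"
  have fB: "subgroup (f ` B) G" using B by (rule f.subgroup_img_is_subgroup)
  interpret fB: subgroup "f ` B" G by fact
  have L: "subgroup ?L G"
    by (rule subgroupI) (use f.hom_one fB.m_closed fB.m_inv_closed in auto)
  have Z: "subgroup {a \<in> B. f a = \<one>} G"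
    by (rule f.subgroup_kernel_within[OF B])
  have "subgroup_index G (carrier G) B = subgroup_index G (carrier G) ?L * subgroup_index G ?L B"
    using L B by (intro subgroup_index_mult) (auto intro: subgroup_self)
  moreover have "subgroup_index G (carrier G) ?L
      = card ((\<lambda>c. f ` B #> c) ` f ` carrier G)"
    unfolding image_image
  proof (rule subgroup_index_eq_card_image_iff[OF L])
    fix a b assume "a \<in> carrier G" "b \<in> carrier G"
    then show "f ` B #> f a = f ` B #> f b \<longleftrightarrow> a \<otimes> inv b \<in> ?L"
      by (simp add: rcos_eq_iff[OF fB])
  qed simp
  moreover have "subgroup_index G ?L B = subgroup_index G ?Z {a \<in> B. f a = \<one>}"
  proof -
    have "subgroup_index G ?Z {a \<in> B. f a = \<one>} = card ((\<lambda>a. B #> a) ` ?Z)"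
      by (rule subgroup_index_eq_card_image_iff[OF Z]) (auto simp: rcos_eq_iff[OF B])
    also have "(\<lambda>a. B #> a) ` ?Z = (\<lambda>a. B #> a) ` ?L"
    proof
      show "(\<lambda>a. B #> a) ` ?Z \<subseteq> (\<lambda>a. B #> a) ` ?L" using fB.one_closed by auto
      show "(\<lambda>a. B #> a) ` ?L \<subseteq> (\<lambda>a. B #> a) ` ?Z"
      proof clarify
        fix a b assume a: "a \<in> carrier G" and b: "b \<in> B" and eq: "f a = f b"
        have "(a \<otimes> inv b) \<otimes> inv a = inv b"
          using a b by (simp add: m_comm[of a] m_assoc)
        then have "B #> (a \<otimes> inv b) = B #> a"
          using a b by (subst rcos_eq_iff[OF B]) auto
        moreover have "a \<otimes> inv b \<in> ?Z" using a b eq by simp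
        ultimately show "B #> a \<in> (\<lambda>a. B #> a) ` ?Z" by (metis image_eqI)
      qed
    qed
    also have "card \<dots> = subgroup_index G ?L B"
      by (simp add: subgroup_index_eq_card_image[where \<psi>="\<lambda>a. B #> a"])
    finally show ?thesis ..
  qed
  moreover have "card ((\<lambda>c. f ` B #> c) ` f ` carrier G)
      = subgroup_index G (f ` carrier G) (f ` B)"
    by (simp add: subgroup_index_eq_card_image[where \<psi>="\<lambda>c. f ` B #> c"])
  ultimately show ?thesis by simp
qed

section \<open>Herbrand quotients and subgroups of finite index\<close>

text \<open>
  The Herbrand quotient \<open>(ker f : im g) / (ker g : im f)\<close> does not change when the group is
  replaced by a subgroup \<open>B\<close> of finite index. Computing \<open>(ker f : g B)\<close> through \<open>im g\<close> and through
  \<open>ker f \<inter> B\<close> gives one relation between the indices, exchanging \<open>f\<close> and \<open>g\<close> another; in the quotient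
  of the two, the correction factors cancel because \<open>(im f : f B) (ker f : ker f \<inter> B)\<close> and
  \<open>(im g : g B) (ker g : ker g \<inter> B)\<close> are both the index of \<open>B\<close>. The statement is cross-multiplied, so
  that it makes sense without knowing that the indices are finite; since an infinite index counts as
  \<open>0\<close>, the second conclusion transfers finiteness from \<open>B\<close> to the whole group.
\<close>

lemma herbrand_quotient_finite_index:
  assumes f: "f \<in> hom G G" and g: "g \<in> hom G G"
    and fg: "\<And>a. a \<in> carrier G \<Longrightarrow> f (g a) = \<one>" and gf: "\<And>a. a \<in> carrier G \<Longrightarrow> g (f a) = \<one>"
    and B: "subgroup B G" "f ` B \<subseteq> B" "g ` B \<subseteq> B" and fin: "finite (rcosets B)"
  defines "p \<equiv> subgroup_index G {a \<in> carrier G. f a = \<one>} (g ` carrier G)"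
    and "q \<equiv> subgroup_index G {a \<in> carrier G. g a = \<one>} (f ` carrier G)"
    and "p' \<equiv> subgroup_index G {a \<in> B. f a = \<one>} (g ` B)"
    and "q' \<equiv> subgroup_index G {a \<in> B. g a = \<one>} (f ` B)"
  shows "p * q' = q * p'" and "q' \<noteq> 0 \<Longrightarrow> q \<noteq> 0"
proof -
  interpret f: group_hom G G f by unfold_locales (fact f)
  interpret g: group_hom G G g by unfold_locales (fact g)
  interpret B: subgroup B G by fact
  have "rcosets B \<noteq> {}" by (auto simp: RCOSETS_def)
  with fin have nz: "card (rcosets B) \<noteq> 0" by simp
  have chain: "subgroup_index G {a \<in> carrier G. h a = \<one>} (k ` carrier G)
        * subgroup_index G (k ` carrier G) (k ` B)
      = subgroup_index G {a \<in> carrier G. h a = \<one>} {a \<in> B. h a = \<one>}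
        * subgroup_index G {a \<in> B. h a = \<one>} (k ` B)"
    if h: "group_hom G G h" and k: "group_hom G G k"
      and hk: "\<And>a. a \<in> carrier G \<Longrightarrow> h (k a) = \<one>" and kB: "k ` B \<subseteq> B" for h k
  proof -
    interpret h: group_hom G G h by fact
    interpret k: group_hom G G k by fact
    have Z: "subgroup {a \<in> carrier G. h a = \<one>} G" "subgroup {a \<in> B. h a = \<one>} G"
      using h.subgroup_kernel_within B(1) subgroup_self by blast+
    note I = k.subgroup_img_is_subgroup[OF subgroup_self] k.subgroup_img_is_subgroup[OF B(1)]
    have "subgroup_index G {a \<in> carrier G. h a = \<one>} (k ` B)
        = subgroup_index G {a \<in> carrier G. h a = \<one>} (k ` carrier G)
        * subgroup_index G (k ` carrier G) (k ` B)"
      by (rule subgroup_index_mult) (use Z I hk in auto)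
    moreover have "subgroup_index G {a \<in> carrier G. h a = \<one>} (k ` B)
        = subgroup_index G {a \<in> carrier G. h a = \<one>} {a \<in> B. h a = \<one>}
        * subgroup_index G {a \<in> B. h a = \<one>} (k ` B)"
      by (rule subgroup_index_mult) (use Z I hk kB in auto)
    ultimately show ?thesis by simp
  qed
  \<comment> \<open>The four correction factors, named so that \<open>v * u\<close> and \<open>w * s\<close> are the index of \<open>B\<close>.\<close>
  define u where "u = subgroup_index G {a \<in> carrier G. f a = \<one>} {a \<in> B. f a = \<one>}"
  define s where "s = subgroup_index G {a \<in> carrier G. g a = \<one>} {a \<in> B. g a = \<one>}"
  define v where "v = subgroup_index G (f ` carrier G) (f ` B)"
  define w where "w = subgroup_index G (g ` carrier G) (g ` B)"
  have pw: "p * w = u * p'"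
    unfolding p_def p'_def u_def w_def using chain[OF f.group_hom_axioms g.group_hom_axioms] fg B by blast
  have qv: "q * v = s * q'"
    unfolding q_def q'_def s_def v_def using chain[OF g.group_hom_axioms f.group_hom_axioms] gf B by blast
  have vu: "v * u = card (rcosets B)" and ws: "w * s = card (rcosets B)"
    unfolding u_def v_def w_def s_def
    using subgroup_index_image_kernel[OF f B(1)] subgroup_index_image_kernel[OF g B(1)] by auto
  have "(p * q') * (w * s) = (p * w) * (s * q')" by simp
  also have "\<dots> = (q * p') * (v * u)" unfolding pw qv[symmetric] by simp
  finally show "p * q' = q * p'" using vu ws nz by simp
  show "q \<noteq> 0" if "q' \<noteq> 0"
  proof -
    have "s * q' \<noteq> 0" using that ws nz by (metis mult_eq_0_iff)
    then show ?thesis using qv by (metis mult_eq_0_iff)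
  qed
qed

end

section \<open>Actions on abelian groups\<close>

context G_module
begin

sublocale G: group G
  using group_hom group_hom.axioms(1) by auto

lemma act_closed [simp, intro]: "g \<in> carrier G \<Longrightarrow> a \<in> carrier A \<Longrightarrow> \<phi> g a \<in> carrier A"
  using element_image by blast

lemma act_group_hom: "g \<in> carrier G \<Longrightarrow> group_hom A A (\<phi> g)"
  by unfold_locales (rule action_hom)

lemma act_mult [simp]:
  "g \<in> carrier G \<Longrightarrow> a \<in> carrier A \<Longrightarrow> b \<in> carrier A \<Longrightarrow> \<phi> g (a \<otimes>\<^bsub>A\<^esub> b) = \<phi> g a \<otimes>\<^bsub>A\<^esub> \<phi> g b"
  by (simp add: group_hom.hom_mult act_group_hom)

lemma act_inv [simp]:
  "g \<in> carrier G \<Longrightarrow> a \<in> carrier A \<Longrightarrow> \<phi> g (inv\<^bsub>A\<^esub> a) = inv\<^bsub>A\<^esub> (\<phi> g a)"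
  by (simp add: group_hom.hom_inv act_group_hom)

lemma act_one [simp]: "g \<in> carrier G \<Longrightarrow> \<phi> g \<one>\<^bsub>A\<^esub> = \<one>\<^bsub>A\<^esub>"
  by (simp add: group_hom.hom_one act_group_hom)

lemma act_identity [simp]: "a \<in> carrier A \<Longrightarrow> \<phi> \<one>\<^bsub>G\<^esub> a = a"
  using id_eq_one by (metis restrict_apply')

lemma act_comp: "g \<in> carrier G \<Longrightarrow> h \<in> carrier G \<Longrightarrow> a \<in> carrier A \<Longrightarrow> \<phi> (g \<otimes>\<^bsub>G\<^esub> h) a = \<phi> g (\<phi> h a)"
  by (simp add: composition_rule)

lemma norm_closed [simp, intro]: "a \<in> carrier A \<Longrightarrow> norm_map G A \<phi> a \<in> carrier A"
  by (auto simp: norm_map_def)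

lemma norm_hom: "norm_map G A \<phi> \<in> hom A A"
proof (rule homI)
  fix a b assume ab: "a \<in> carrier A" "b \<in> carrier A"
  have "norm_map G A \<phi> (a \<otimes>\<^bsub>A\<^esub> b) = (\<Otimes>\<^bsub>A\<^esub>g\<in>carrier G. \<phi> g a \<otimes>\<^bsub>A\<^esub> \<phi> g b)"
    unfolding norm_map_def by (rule A.finprod_cong') (use ab in auto)
  also have "\<dots> = norm_map G A \<phi> a \<otimes>\<^bsub>A\<^esub> norm_map G A \<phi> b"
    unfolding norm_map_def by (rule A.finprod_multf) (use ab in auto)
  finally show "norm_map G A \<phi> (a \<otimes>\<^bsub>A\<^esub> b) = norm_map G A \<phi> a \<otimes>\<^bsub>A\<^esub> norm_map G A \<phi> b" .
qed simp

end

section \<open>Cohomology of cyclic groups\<close>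

lemma (in group) finite_cyclic_group_powers:
  assumes "finite (carrier G)" "cyclic_group G"
  obtains \<sigma> and n :: nat where "\<sigma> \<in> carrier G"
    and "bij_betw (\<lambda>i. \<sigma> [^] i) {..<n} (carrier G)" and "\<sigma> [^] n = \<one>"
proof -
  obtain \<sigma> where \<sigma>: "\<sigma> \<in> carrier G" and gen: "carrier G = range (\<lambda>k::int. \<sigma> [^] k)"
    using assms(2) cyclic_group by blast
  let ?n = "ord \<sigma>"
  have pos: "0 < ?n" using ord_ge_1[OF assms(1) \<sigma>] by simp
  have "inj_on (\<lambda>i. \<sigma> [^] i) {..<?n}"
  proof -
    have "{0..?n - 1} = {..<?n}" using pos by auto
    then show ?thesis using ord_inj[OF \<sigma>] by simp
  qed
  moreover have "(\<lambda>i. \<sigma> [^] i) ` {..<?n} = carrier G"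
  proof
    show "(\<lambda>i. \<sigma> [^] i) ` {..<?n} \<subseteq> carrier G" using \<sigma> by auto
    show "carrier G \<subseteq> (\<lambda>i. \<sigma> [^] i) ` {..<?n}"
    proof
      fix g assume "g \<in> carrier G"
      then obtain k :: int where g: "g = \<sigma> [^] k" using gen by auto
      have "\<sigma> [^] k = \<sigma> [^] (int ?n * (k div int ?n) + k mod int ?n)" by simp
      also have "\<dots> = (\<sigma> [^] int ?n) [^] (k div int ?n) \<otimes> \<sigma> [^] (k mod int ?n)"
        using \<sigma> by (simp only: int_pow_mult int_pow_pow)
      also have "\<dots> = \<sigma> [^] (k mod int ?n)" using \<sigma> by (simp add: int_pow_int)
      also have "\<dots> = \<sigma> [^] nat (k mod int ?n)"
        using pos by (simp flip: int_pow_int)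
      finally have "g = \<sigma> [^] nat (k mod int ?n)" unfolding g .
      moreover have "nat (k mod int ?n) < ?n" using pos by (simp add: nat_less_iff)
      ultimately show "g \<in> (\<lambda>i. \<sigma> [^] i) ` {..<?n}" by blast
    qed
  qed
  ultimately show thesis using that[of \<sigma> ?n] \<sigma> by (auto simp: bij_betw_def)
qed

locale cyclic_G_module = G_module G A \<phi>
  for G (structure) and A and \<phi> +
  fixes \<sigma> and n :: nat
  assumes gen_closed [simp, intro]: "\<sigma> \<in> carrier G"
    and gen_bij: "bij_betw (\<lambda>i. \<sigma> [^] i) {..<n} (carrier G)"
    and gen_pow_order [simp]: "\<sigma> [^] n = \<one>"
begin

definition gen_minus_one where "gen_minus_one a = \<phi> \<sigma> a \<otimes>\<^bsub>A\<^esub> inv\<^bsub>A\<^esub> a"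

text \<open>
  Written additively, \<open>partial_norm k\<close> is \<open>1 + \<sigma> + \<dots> + \<sigma>\<^bsup>k-1\<^esup>\<close>. It telescopes against \<open>\<sigma> - 1\<close>, is
  the norm for \<open>k = n\<close>, and gives the value at \<open>\<sigma>\<^sup>k\<close> of a crossed homomorphism in terms of its value
  at \<open>\<sigma>\<close>.
\<close>

definition partial_norm where "partial_norm (k :: nat) a = (\<Otimes>\<^bsub>A\<^esub>i\<in>{..<k}. \<phi> (\<sigma> [^] i) a)"

lemma order_pos: "0 < n"
  using gen_bij G.one_closed by (auto simp: bij_betw_def)

lemma carrier_eq_powers: "g \<in> carrier G \<longleftrightarrow> (\<exists>k::nat. g = \<sigma> [^] k)"
  using gen_bij by (auto simp: bij_betw_def)

lemma gen_pow_mod: "\<sigma> [^] (k mod n) = \<sigma> [^] k"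
proof -
  have "\<sigma> [^] k = \<sigma> [^] (n * (k div n) + k mod n)" by simp
  also have "\<dots> = (\<sigma> [^] n) [^] (k div n) \<otimes> \<sigma> [^] (k mod n)"
    by (simp only: G.nat_pow_mult[symmetric] G.nat_pow_pow gen_closed)
  finally show ?thesis by simp
qed

lemma gen_minus_one_closed [simp, intro]: "a \<in> carrier A \<Longrightarrow> gen_minus_one a \<in> carrier A"
  by (simp add: gen_minus_one_def)

lemma gen_minus_one_hom: "gen_minus_one \<in> hom A A"
  by (rule homI) (auto simp: gen_minus_one_def A.inv_mult A.m_ac)

lemma partial_norm_closed [simp, intro]: "a \<in> carrier A \<Longrightarrow> partial_norm k a \<in> carrier A"
  by (auto simp: partial_norm_def)

lemma partial_norm_0 [simp]: "partial_norm 0 a = \<one>\<^bsub>A\<^esub>"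
  by (simp add: partial_norm_def)

lemma partial_norm_Suc:
  "a \<in> carrier A \<Longrightarrow> partial_norm (Suc k) a = partial_norm k a \<otimes>\<^bsub>A\<^esub> \<phi> (\<sigma> [^] k) a"
  by (simp add: partial_norm_def lessThan_Suc A.finprod_insert A.m_comm Pi_def)

lemma partial_norm_1 [simp]: "a \<in> carrier A \<Longrightarrow> partial_norm (Suc 0) a = a"
  by (simp add: partial_norm_Suc)

text \<open>
  This is the cocycle relation on powers of the generator: for \<open>c\<close> of trivial norm it makes
  \<open>\<sigma>\<^sup>k \<mapsto> partial_norm k c\<close> a crossed homomorphism.
\<close>

lemma partial_norm_add:
  "a \<in> carrier A \<Longrightarrow>
    partial_norm (j + k) a = partial_norm j a \<otimes>\<^bsub>A\<^esub> \<phi> (\<sigma> [^] j) (partial_norm k a)"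
  by (induction k) (simp_all add: partial_norm_Suc A.m_assoc act_comp flip: G.nat_pow_mult)

lemma partial_norm_gen_minus_one:
  "a \<in> carrier A \<Longrightarrow> partial_norm k (gen_minus_one a) = \<phi> (\<sigma> [^] k) a \<otimes>\<^bsub>A\<^esub> inv\<^bsub>A\<^esub> a"
proof (induction k)
  case (Suc k)
  let ?b = "\<phi> (\<sigma> [^] k) a" and ?c = "\<phi> (\<sigma> [^] k) (\<phi> \<sigma> a)"
  have "partial_norm (Suc k) (gen_minus_one a)
      = (?b \<otimes>\<^bsub>A\<^esub> inv\<^bsub>A\<^esub> a) \<otimes>\<^bsub>A\<^esub> (?c \<otimes>\<^bsub>A\<^esub> inv\<^bsub>A\<^esub> ?b)"
    using Suc by (simp add: partial_norm_Suc) (simp add: gen_minus_one_def)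
  also have "\<dots> = (?c \<otimes>\<^bsub>A\<^esub> inv\<^bsub>A\<^esub> a) \<otimes>\<^bsub>A\<^esub> (?b \<otimes>\<^bsub>A\<^esub> inv\<^bsub>A\<^esub> ?b)"
    using Suc.prems by (simp only: A.m_ac act_closed A.inv_closed A.m_closed gen_closed G.nat_pow_closed)
  finally show ?case using Suc.prems by (simp add: act_comp)
qed simp

lemma gen_minus_one_partial_norm:
  "a \<in> carrier A \<Longrightarrow> gen_minus_one (partial_norm k a) = \<phi> (\<sigma> [^] k) a \<otimes>\<^bsub>A\<^esub> inv\<^bsub>A\<^esub> a"
proof (induction k)
  case (Suc k)
  let ?b = "\<phi> (\<sigma> [^] k) a" and ?c = "\<phi> \<sigma> (\<phi> (\<sigma> [^] k) a)"
  have "gen_minus_one (partial_norm (Suc k) a)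
      = gen_minus_one (partial_norm k a) \<otimes>\<^bsub>A\<^esub> gen_minus_one ?b"
    using Suc.prems by (simp add: partial_norm_Suc hom_mult[OF gen_minus_one_hom])
  also have "\<dots> = (?b \<otimes>\<^bsub>A\<^esub> inv\<^bsub>A\<^esub> a) \<otimes>\<^bsub>A\<^esub> (?c \<otimes>\<^bsub>A\<^esub> inv\<^bsub>A\<^esub> ?b)"
    using Suc by (simp add: gen_minus_one_def)
  also have "\<dots> = (?c \<otimes>\<^bsub>A\<^esub> inv\<^bsub>A\<^esub> a) \<otimes>\<^bsub>A\<^esub> (?b \<otimes>\<^bsub>A\<^esub> inv\<^bsub>A\<^esub> ?b)"
    using Suc.prems by (simp only: A.m_ac act_closed A.inv_closed A.m_closed gen_closed G.nat_pow_closed)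
  also have "?c = \<phi> (\<sigma> [^] Suc k) a"
    using Suc.prems by (simp only: act_comp[symmetric] gen_closed G.nat_pow_closed G.nat_pow_Suc2)
  finally show ?case using Suc.prems by simp
qed (simp add: gen_minus_one_def)

lemma norm_eq_partial_norm: "a \<in> carrier A \<Longrightarrow> norm_map G A \<phi> a = partial_norm n a"
proof -
  assume a: "a \<in> carrier A"
  have "inj_on (\<lambda>i. \<sigma> [^] i) {..<n}" "(\<lambda>i. \<sigma> [^] i) ` {..<n} = carrier G"
    using gen_bij by (auto simp: bij_betw_def)
  then show ?thesis
    unfolding norm_map_def partial_norm_def
    using A.finprod_reindex[of "\<lambda>g. \<phi> g a" "\<lambda>i. \<sigma> [^] i" "{..<n}"] a by (auto simp: Pi_def)
qed

lemma norm_gen_minus_one: "a \<in> carrier A \<Longrightarrow> norm_map G A \<phi> (gen_minus_one a) = \<one>\<^bsub>A\<^esub>"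
  by (simp add: norm_eq_partial_norm partial_norm_gen_minus_one)

lemma gen_minus_one_norm: "a \<in> carrier A \<Longrightarrow> gen_minus_one (norm_map G A \<phi> a) = \<one>\<^bsub>A\<^esub>"
  by (simp add: norm_eq_partial_norm gen_minus_one_partial_norm)

text \<open>
  Being fixed by the generator is enough to be fixed by the group: \<open>(\<sigma>\<^sup>k - 1) a\<close> is a partial norm
  of \<open>(\<sigma> - 1) a\<close>.
\<close>

lemma gen_minus_one_eq_one_iff:
  assumes "a \<in> carrier A"
  shows "gen_minus_one a = \<one>\<^bsub>A\<^esub> \<longleftrightarrow> (\<forall>g\<in>carrier G. \<phi> g a = a)"
proof
  assume "gen_minus_one a = \<one>\<^bsub>A\<^esub>"
  then have "\<phi> (\<sigma> [^] k) a \<otimes>\<^bsub>A\<^esub> inv\<^bsub>A\<^esub> a = \<one>\<^bsub>A\<^esub>" for k :: nat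
    using partial_norm_gen_minus_one[OF assms, of k] by (simp add: partial_norm_def)
  then have "\<phi> (\<sigma> [^] k) a = a" for k :: nat
    using assms A.inv_solve_right'[of "\<one>\<^bsub>A\<^esub>" "\<phi> (\<sigma> [^] k) a" a] by simp
  then show "\<forall>g\<in>carrier G. \<phi> g a = a" by (auto simp: carrier_eq_powers)
next
  assume "\<forall>g\<in>carrier G. \<phi> g a = a"
  then show "gen_minus_one a = \<one>\<^bsub>A\<^esub>" using assms by (simp add: gen_minus_one_def)
qed

lemma fixed_points_eq_kernel: "fixed_points G A \<phi> = {a \<in> carrier A. gen_minus_one a = \<one>\<^bsub>A\<^esub>}"
  by (auto simp: fixed_points_def gen_minus_one_eq_one_iff)

lemma cocycle_gen_pow:
  assumes "f \<in> cocycles1 G A \<phi>"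
  shows "f (\<sigma> [^] k) = partial_norm k (f \<sigma>)"
proof -
  have mult: "f (g \<otimes> h) = f g \<otimes>\<^bsub>A\<^esub> \<phi> g (f h)"
    if "g \<in> carrier G" "h \<in> carrier G" for g h
    using assms that by (auto simp: cocycles1_def)
  have closed: "f g \<in> carrier A" if "g \<in> carrier G" for g
    using assms that by (auto simp: cocycles1_def)
  have f1: "f \<one> = \<one>\<^bsub>A\<^esub>"
    using mult[of \<one> \<one>] closed[of \<one>] by simp
  show ?thesis
    by (induction k) (simp_all add: f1 mult closed partial_norm_Suc)
qed

lemma cocycle_eqI:
  assumes "f \<in> cocycles1 G A \<phi>" "h \<in> cocycles1 G A \<phi>" "f \<sigma> = h \<sigma>"
  shows "f = h"
proof (rule PiE_ext)
  show "f \<in> carrier G \<rightarrow>\<^sub>E carrier A" "h \<in> carrier G \<rightarrow>\<^sub>E carrier A"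
    using assms by (auto simp: cocycles1_def)
  show "f g = h g" if "g \<in> carrier G" for g
    using that assms by (auto simp: carrier_eq_powers cocycle_gen_pow)
qed

lemma coboundaries_subset_cocycles: "coboundaries1 G A \<phi> \<subseteq> cocycles1 G A \<phi>"
proof
  fix f assume "f \<in> coboundaries1 G A \<phi>"
  then obtain a where a: "a \<in> carrier A" and f: "f = (\<lambda>g\<in>carrier G. \<phi> g a \<otimes>\<^bsub>A\<^esub> inv\<^bsub>A\<^esub> a)"
    by (auto simp: coboundaries1_def)
  have "\<phi> (g \<otimes> h) a \<otimes>\<^bsub>A\<^esub> inv\<^bsub>A\<^esub> a
      = (\<phi> g a \<otimes>\<^bsub>A\<^esub> inv\<^bsub>A\<^esub> a) \<otimes>\<^bsub>A\<^esub> \<phi> g (\<phi> h a \<otimes>\<^bsub>A\<^esub> inv\<^bsub>A\<^esub> a)"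
    if "g \<in> carrier G" "h \<in> carrier G" for g h
  proof -
    let ?b = "\<phi> g a" and ?c = "\<phi> g (\<phi> h a)"
    have "(?b \<otimes>\<^bsub>A\<^esub> inv\<^bsub>A\<^esub> a) \<otimes>\<^bsub>A\<^esub> (?c \<otimes>\<^bsub>A\<^esub> inv\<^bsub>A\<^esub> ?b) = (?c \<otimes>\<^bsub>A\<^esub> inv\<^bsub>A\<^esub> a) \<otimes>\<^bsub>A\<^esub> (?b \<otimes>\<^bsub>A\<^esub> inv\<^bsub>A\<^esub> ?b)"
      using that a by (simp only: A.m_ac act_closed A.inv_closed A.m_closed)
    then show ?thesis using that a by (simp add: act_comp)
  qed
  then show "f \<in> cocycles1 G A \<phi>" using a by (auto simp: cocycles1_def f)
qed

text \<open>
  A crossed homomorphism is determined by its value at \<open>\<sigma>\<close>, and the principal one attached to \<open>a\<close>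
  has the value \<open>(\<sigma> - 1) a\<close> there.
\<close>

lemma coboundary_iff:
  assumes "f \<in> cocycles1 G A \<phi>"
  shows "f \<in> coboundaries1 G A \<phi> \<longleftrightarrow> f \<sigma> \<in> gen_minus_one ` carrier A"
proof
  assume "f \<in> coboundaries1 G A \<phi>"
  then show "f \<sigma> \<in> gen_minus_one ` carrier A" by (auto simp: coboundaries1_def gen_minus_one_def)
next
  assume "f \<sigma> \<in> gen_minus_one ` carrier A"
  then obtain a where a: "a \<in> carrier A" "f \<sigma> = gen_minus_one a" by blast
  let ?h = "\<lambda>g\<in>carrier G. \<phi> g a \<otimes>\<^bsub>A\<^esub> inv\<^bsub>A\<^esub> a"
  have h: "?h \<in> coboundaries1 G A \<phi>" using a by (auto simp: coboundaries1_def)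
  moreover have "f = ?h"
    by (rule cocycle_eqI) (use assms a h coboundaries_subset_cocycles in \<open>auto simp: gen_minus_one_def\<close>)
  ultimately show "f \<in> coboundaries1 G A \<phi>" by simp
qed

text \<open>
  A value \<open>f \<sigma>\<close> has norm \<open>f (\<sigma>\<^sup>n) = f \<one>\<close>, which is trivial. Conversely, an element \<open>a\<close> of trivial norm
  is the value at \<open>\<sigma>\<close> of \<open>\<sigma>\<^sup>k \<mapsto> partial_norm k a\<close>; this is well defined because the partial norms of \<open>a\<close>
  are then periodic in \<open>k\<close> with period \<open>n\<close>.
\<close>

lemma cocycle_values_at_gen:
  "(\<lambda>f. f \<sigma>) ` cocycles1 G A \<phi> = {a \<in> carrier A. norm_map G A \<phi> a = \<one>\<^bsub>A\<^esub>}"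
proof (intro equalityI subsetI)
  fix a assume "a \<in> (\<lambda>f. f \<sigma>) ` cocycles1 G A \<phi>"
  then obtain f where f: "f \<in> cocycles1 G A \<phi>" "a = f \<sigma>" by blast
  then have a: "a \<in> carrier A" by (auto simp: cocycles1_def)
  have "partial_norm n a = partial_norm 0 a"
    using f cocycle_gen_pow[OF f(1), of n] cocycle_gen_pow[OF f(1), of 0]
    by (simp del: partial_norm_0)
  then show "a \<in> {a \<in> carrier A. norm_map G A \<phi> a = \<one>\<^bsub>A\<^esub>}"
    using a by (simp add: norm_eq_partial_norm)
next
  fix a assume "a \<in> {a \<in> carrier A. norm_map G A \<phi> a = \<one>\<^bsub>A\<^esub>}"
  then have a: "a \<in> carrier A" and N: "partial_norm n a = \<one>\<^bsub>A\<^esub>"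
    by (auto simp: norm_eq_partial_norm)
  have mult: "partial_norm (n * m) a = \<one>\<^bsub>A\<^esub>" for m
    by (induction m) (simp_all add: partial_norm_add a N)
  have per: "partial_norm (k mod n) a = partial_norm k a" for k
  proof -
    have "\<sigma> [^] (n * m) = \<one>" for m
      using G.nat_pow_pow[OF gen_closed, of n m] by simp
    then have "partial_norm (n * m + j) a = partial_norm j a" for m j
      using a by (simp add: partial_norm_add mult)
    from this[of "k div n" "k mod n"] show ?thesis by simp
  qed
  define dlog where "dlog = inv_into {..<n} (\<lambda>i. \<sigma> [^] i)"
  have dlog: "dlog (\<sigma> [^] k) = k mod n" for k
  proof -
    have "dlog (\<sigma> [^] (k mod n)) = k mod n"
      unfolding dlog_def using gen_bij order_pos
      by (intro inv_into_f_f) (auto simp: bij_betw_def)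
    then show ?thesis by (simp add: gen_pow_mod)
  qed
  let ?f = "\<lambda>g\<in>carrier G. partial_norm (dlog g) a"
  have f: "?f (\<sigma> [^] k) = partial_norm k a" for k :: nat
    by (simp add: dlog per)
  have "?f (g \<otimes> h) = ?f g \<otimes>\<^bsub>A\<^esub> \<phi> g (?f h)" if gh: "g \<in> carrier G" "h \<in> carrier G" for g h
  proof -
    obtain j k :: nat where jk: "g = \<sigma> [^] j" "h = \<sigma> [^] k" using gh carrier_eq_powers by blast
    have "?f (g \<otimes> h) = ?f (\<sigma> [^] (j + k))" by (simp add: jk G.nat_pow_mult)
    then show ?thesis using a by (simp only: f jk partial_norm_add)
  qed
  then have "?f \<in> cocycles1 G A \<phi>" using a by (auto simp: cocycles1_def)
  moreover have "?f \<sigma> = a" using f[of "Suc 0"] a by (simp del: restrict_apply)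
  ultimately show "a \<in> (\<lambda>f. f \<sigma>) ` cocycles1 G A \<phi>" by (metis image_eqI)
qed

lemma gen_minus_one_image_subgroup: "subgroup (gen_minus_one ` carrier A) A"
proof -
  interpret gen_minus_one: group_hom A A gen_minus_one by unfold_locales (rule gen_minus_one_hom)
  show ?thesis by (rule gen_minus_one.img_is_subgroup)
qed

text \<open>
  Evaluation at the generator identifies \<open>H\<^sup>1\<close> with the kernel of the norm modulo the image of
  \<open>\<sigma> - 1\<close>: it maps the cocycles onto the kernel, and the coboundaries are exactly
  the cocycles whose value at \<open>\<sigma>\<close> lies in that image.
\<close>

lemma order_H1:
  "order (H1 G A \<phi>) =
    subgroup_index A {a \<in> carrier A. norm_map G A \<phi> a = \<one>\<^bsub>A\<^esub>} (gen_minus_one ` carrier A)"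
proof -
  let ?P = "product_group (carrier G) (\<lambda>_. A)"
  let ?\<psi> = "\<lambda>f. (gen_minus_one ` carrier A) #>\<^bsub>A\<^esub> (f \<sigma>)"
  interpret P: group ?P by (simp add: A.is_group)
  have cocycle: "f \<in> carrier ?P" "f g \<in> carrier A"
    if "f \<in> cocycles1 G A \<phi>" "g \<in> carrier G" for f g
    using that by (auto simp: cocycles1_def)
  interpret \<delta>: group_hom A ?P "\<lambda>a. \<lambda>g\<in>carrier G. \<phi> g a \<otimes>\<^bsub>A\<^esub> inv\<^bsub>A\<^esub> a"
    by unfold_locales (rule homI, auto simp: A.inv_mult A.m_ac intro!: restrict_ext)
  have "coboundaries1 G A \<phi> = (\<lambda>a. \<lambda>g\<in>carrier G. \<phi> g a \<otimes>\<^bsub>A\<^esub> inv\<^bsub>A\<^esub> a) ` carrier A"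
    by (auto simp: coboundaries1_def)
  then have sub: "subgroup (coboundaries1 G A \<phi>) ?P"
    using \<delta>.img_is_subgroup by simp
  have "order (H1 G A \<phi>) = subgroup_index ?P (cocycles1 G A \<phi>) (coboundaries1 G A \<phi>)"
    by (simp add: order_def H1_def FactGroup_def)
  also have "\<dots> = card (?\<psi> ` cocycles1 G A \<phi>)"
  proof (rule P.subgroup_index_eq_card_image_iff[OF sub])
    fix f h assume f: "f \<in> cocycles1 G A \<phi>" and h: "h \<in> cocycles1 G A \<phi>"
    let ?d = "\<lambda>g\<in>carrier G. f g \<otimes>\<^bsub>A\<^esub> inv\<^bsub>A\<^esub> (h g)"
    have d: "f \<otimes>\<^bsub>?P\<^esub> inv\<^bsub>?P\<^esub> h = ?d"
      using cocycle(1)[OF h gen_closed] A.is_group by (auto simp: intro!: restrict_ext)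
    have "?d \<in> cocycles1 G A \<phi>"
      using f h cocycle by (auto simp: cocycles1_def A.inv_mult A.m_ac)
    then have "?d \<in> coboundaries1 G A \<phi> \<longleftrightarrow> ?d \<sigma> \<in> gen_minus_one ` carrier A"
      by (rule coboundary_iff)
    then show "?\<psi> f = ?\<psi> h \<longleftrightarrow> f \<otimes>\<^bsub>?P\<^esub> inv\<^bsub>?P\<^esub> h \<in> coboundaries1 G A \<phi>"
      unfolding d using cocycle f h by (simp add: A.rcos_eq_iff[OF gen_minus_one_image_subgroup])
  qed (use cocycle in blast)
  also have "?\<psi> ` cocycles1 G A \<phi>
      = (\<lambda>a. (gen_minus_one ` carrier A) #>\<^bsub>A\<^esub> a) ` {a \<in> carrier A. norm_map G A \<phi> a = \<one>\<^bsub>A\<^esub>}"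
    by (simp only: cocycle_values_at_gen[symmetric] image_image)
  also have "card \<dots> = subgroup_index A {a \<in> carrier A. norm_map G A \<phi> a = \<one>\<^bsub>A\<^esub>} (gen_minus_one ` carrier A)"
    by (rule subgroup_index_eq_card_image[symmetric]) simp
  finally show ?thesis .
qed

text \<open>
  Together with \<open>order_H1\<close>, this makes the cohomological Herbrand quotient the one of the pair of
  endomorphisms \<open>\<sigma> - 1\<close> and \<open>N\<^sub>G\<close>.
\<close>

lemma order_Tate_H0:
  "order (Tate_H0 G A \<phi>) =
    subgroup_index A {a \<in> carrier A. gen_minus_one a = \<one>\<^bsub>A\<^esub>} (norm_map G A \<phi> ` carrier A)"
  by (simp add: order_def Tate_H0_def FactGroup_def norm_image_def fixed_points_eq_kernel)

end

section \<open>Permutation modules\<close>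

locale permutation_module = G_module G A \<phi>
  for G (structure) and A and \<phi> +
  fixes B S R
  assumes finite_G: "finite (carrier G)"
    and submodule: "G_submodule G A \<phi> B"
    and basis: "finite_Z_basis A B S"
    and perm: "\<And>g. g \<in> carrier G \<Longrightarrow> \<phi> g ` S \<subseteq> S"
    and R_subset: "R \<subseteq> S"
    and R_unique: "\<And>Y. Y \<in> orbits G S \<phi> \<Longrightarrow> \<exists>!x. x \<in> R \<inter> Y"
begin

definition lincomb where "lincomb c = (\<Otimes>\<^bsub>A\<^esub>x\<in>S. x [^]\<^bsub>A\<^esub> (c x :: int))"

definition rep where "rep x = (THE r. r \<in> R \<inter> orbit G \<phi> x)"

lemma B_subgroup: "subgroup B A"
  using submodule by (simp add: G_submodule_def)

lemma act_B: "g \<in> carrier G \<Longrightarrow> a \<in> B \<Longrightarrow> \<phi> g a \<in> B"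
  using submodule by (auto simp: G_submodule_def)

lemma finite_S: "finite S" and S_subset: "S \<subseteq> carrier A" and B_generated: "generate A S = B"
  using basis by (auto simp: finite_Z_basis_def)

lemma S_closed [simp, intro]: "x \<in> S \<Longrightarrow> x \<in> carrier A"
  using S_subset by blast

lemma act_S [simp, intro]: "g \<in> carrier G \<Longrightarrow> x \<in> S \<Longrightarrow> \<phi> g x \<in> S"
  using perm by blast

lemma S_subset_B: "S \<subseteq> B"
  unfolding B_generated[symmetric] by (intro subsetI generate.incl)

lemma lincomb_closed [simp, intro]: "lincomb c \<in> carrier A"
  by (auto simp: lincomb_def)

lemma lincomb_cong: "(\<And>x. x \<in> S \<Longrightarrow> c x = d x) \<Longrightarrow> lincomb c = lincomb d"
  unfolding lincomb_def by (rule A.finprod_cong') auto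

lemma lincomb_zero [simp]: "lincomb (\<lambda>_. 0) = \<one>\<^bsub>A\<^esub>"
  by (simp add: lincomb_def)

lemma lincomb_add: "lincomb (\<lambda>x. c x + d x) = lincomb c \<otimes>\<^bsub>A\<^esub> lincomb d"
proof -
  have "lincomb (\<lambda>x. c x + d x) = (\<Otimes>\<^bsub>A\<^esub>x\<in>S. x [^]\<^bsub>A\<^esub> c x \<otimes>\<^bsub>A\<^esub> x [^]\<^bsub>A\<^esub> d x)"
    unfolding lincomb_def by (rule A.finprod_cong') (auto simp: A.int_pow_mult)
  then show ?thesis by (simp add: lincomb_def A.finprod_multf Pi_def)
qed

lemma lincomb_uminus: "lincomb (\<lambda>x. - c x) = inv\<^bsub>A\<^esub> lincomb c"
proof -
  have "lincomb (\<lambda>x. - c x) \<otimes>\<^bsub>A\<^esub> lincomb c = \<one>\<^bsub>A\<^esub>"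
    by (simp flip: lincomb_add)
  then show ?thesis by (simp add: A.inv_equality)
qed

lemma lincomb_diff: "lincomb (\<lambda>x. c x - d x) = lincomb c \<otimes>\<^bsub>A\<^esub> inv\<^bsub>A\<^esub> lincomb d"
  using lincomb_add[of c "\<lambda>x. - d x"] by (simp add: lincomb_uminus)

lemma lincomb_sum:
  "finite I \<Longrightarrow> lincomb (\<lambda>x. \<Sum>i\<in>I. c i x) = (\<Otimes>\<^bsub>A\<^esub>i\<in>I. lincomb (c i))"
  by (induction I rule: finite_induct) (simp_all add: lincomb_add Pi_def)

lemma lincomb_single:
  assumes "x \<in> S"
  shows "lincomb (\<lambda>y. if y = x then k else 0) = x [^]\<^bsub>A\<^esub> k"
proof -
  have "lincomb (\<lambda>y. if y = x then k else 0)
      = (\<Otimes>\<^bsub>A\<^esub>y\<in>S. if x = y then y [^]\<^bsub>A\<^esub> k else \<one>\<^bsub>A\<^esub>)"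
    unfolding lincomb_def by (rule A.finprod_cong') auto
  then show ?thesis
    using A.finprod_singleton[of x S "\<lambda>y. y [^]\<^bsub>A\<^esub> k"] assms finite_S by auto
qed

lemma lincomb_eq_one_iff: "lincomb c = \<one>\<^bsub>A\<^esub> \<longleftrightarrow> (\<forall>x\<in>S. c x = 0)"
proof
  assume "lincomb c = \<one>\<^bsub>A\<^esub>"
  then show "\<forall>x\<in>S. c x = 0"
    using basis unfolding finite_Z_basis_def lincomb_def by blast
next
  assume "\<forall>x\<in>S. c x = 0"
  then have "lincomb c = lincomb (\<lambda>_. 0)" by (intro lincomb_cong) auto
  then show "lincomb c = \<one>\<^bsub>A\<^esub>" by simp
qed

lemma lincomb_eq_iff: "lincomb c = lincomb d \<longleftrightarrow> (\<forall>x\<in>S. c x = d x)"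
proof -
  have "lincomb c = lincomb d \<longleftrightarrow> lincomb (\<lambda>x. c x - d x) = \<one>\<^bsub>A\<^esub>"
    unfolding lincomb_diff using A.inv_solve_right'[of "\<one>\<^bsub>A\<^esub>" "lincomb c" "lincomb d"] by simp
  then show ?thesis by (simp add: lincomb_eq_one_iff)
qed

lemma B_eq_range_lincomb: "B = range lincomb"
proof
  have "lincomb c \<in> B" for c
    unfolding lincomb_def
  proof (rule A.finprod_in_subgroup[OF B_subgroup], rule Pi_I)
    show "x [^]\<^bsub>A\<^esub> c x \<in> B" if "x \<in> S" for x
      using that S_subset_B by (intro A.subgroup_int_pow_closed[OF B_subgroup]) auto
  qed
  then show "range lincomb \<subseteq> B" by blast
  have "subgroup (range lincomb) A"
  proof (rule A.subgroupI)
    fix a b assume "a \<in> range lincomb" "b \<in> range lincomb"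
    then show "a \<otimes>\<^bsub>A\<^esub> b \<in> range lincomb" "inv\<^bsub>A\<^esub> a \<in> range lincomb"
      by (auto simp flip: lincomb_add lincomb_uminus)
  qed auto
  moreover have "S \<subseteq> range lincomb"
    using lincomb_single[where k=1] by (metis A.int_pow_1 S_closed rangeI subsetI)
  ultimately show "B \<subseteq> range lincomb"
    unfolding B_generated[symmetric] by (rule A.generate_subgroup_incl[rotated])
qed

section \<open>The action on coefficients\<close>

lemma act_inverse [simp]:
  assumes "g \<in> carrier G" "a \<in> carrier A"
  shows "\<phi> (inv g) (\<phi> g a) = a" "\<phi> g (\<phi> (inv g) a) = a"
proof -
  have "\<phi> (inv g) (\<phi> g a) = \<phi> (inv g \<otimes> g) a" "\<phi> g (\<phi> (inv g) a) = \<phi> (g \<otimes> inv g) a"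
    using assms by (simp_all only: act_comp G.inv_closed)
  then show "\<phi> (inv g) (\<phi> g a) = a" "\<phi> g (\<phi> (inv g) a) = a"
    using assms by simp_all
qed

lemma act_lincomb:
  assumes "g \<in> carrier G"
  shows "\<phi> g (lincomb c) = lincomb (\<lambda>x. c (\<phi> (inv g) x))"
proof -
  interpret g: group_hom A A "\<phi> g" by (rule act_group_hom[OF assms])
  have inj: "inj_on (\<phi> g) S" using inj_prop[OF assms] S_subset by (rule inj_on_subset)
  have surj: "\<phi> g ` S = S" using finite_S perm[OF assms] inj by (rule endo_inj_surj)
  have "\<phi> g (lincomb c) = (\<Otimes>\<^bsub>A\<^esub>x\<in>S. \<phi> g (x [^]\<^bsub>A\<^esub> c x))"
    unfolding lincomb_def by (rule A.hom_finprod[OF action_hom[OF assms]]) auto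
  also have "\<dots> = (\<Otimes>\<^bsub>A\<^esub>x\<in>S. \<phi> g x [^]\<^bsub>A\<^esub> c (\<phi> (inv g) (\<phi> g x)))"
    by (rule A.finprod_cong') (use assms in \<open>auto simp: g.hom_int_pow\<close>)
  also have "\<dots> = (\<Otimes>\<^bsub>A\<^esub>x\<in>\<phi> g ` S. x [^]\<^bsub>A\<^esub> c (\<phi> (inv g) x))"
    by (rule A.finprod_reindex[symmetric]) (use assms inj in auto)
  finally show ?thesis by (simp only: surj lincomb_def)
qed

lemma norm_lincomb: "norm_map G A \<phi> (lincomb c) = lincomb (\<lambda>x. \<Sum>g\<in>carrier G. c (\<phi> g x))"
proof -
  have "norm_map G A \<phi> (lincomb c) = (\<Otimes>\<^bsub>A\<^esub>g\<in>carrier G. lincomb (\<lambda>x. c (\<phi> (inv g) x)))"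
    unfolding norm_map_def by (rule A.finprod_cong') (auto simp: act_lincomb)
  also have "\<dots> = lincomb (\<lambda>x. \<Sum>g\<in>carrier G. c (\<phi> (inv g) x))"
    by (rule lincomb_sum[symmetric]) (rule finite_G)
  also have "\<dots> = lincomb (\<lambda>x. \<Sum>g\<in>carrier G. c (\<phi> g x))"
    by (rule lincomb_cong)
      (rule sum.reindex_bij_witness[where i="\<lambda>g. inv g" and j="\<lambda>g. inv g"]; simp)
  finally show ?thesis .
qed

lemma fixed_lincomb_iff:
  "(\<forall>g\<in>carrier G. \<phi> g (lincomb c) = lincomb c) \<longleftrightarrow> (\<forall>g\<in>carrier G. \<forall>x\<in>S. c (\<phi> g x) = c x)"
  (is "?L \<longleftrightarrow> ?R")
proof
  assume ?L
  then have c: "c (\<phi> (inv g) x) = c x" if "g \<in> carrier G" "x \<in> S" for g x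
    using that by (auto simp: act_lincomb lincomb_eq_iff)
  show ?R using c[OF G.inv_closed] by simp
qed (simp add: act_lincomb lincomb_eq_iff)

section \<open>Orbits and stabilizers of basis elements\<close>

lemma orbit_subset_S: "x \<in> S \<Longrightarrow> orbit G \<phi> x \<subseteq> S"
  by (auto simp: orbit_def)

lemma orbit_act:
  assumes "x \<in> S" "y \<in> orbit G \<phi> x"
  shows "orbit G \<phi> y = orbit G \<phi> x"
proof -
  have "y \<in> S" using assms orbit_subset_S by blast
  then show ?thesis
    using assms orbit_sym[of x y] orbit_trans[of x y] orbit_trans[of y x] orbit_subset_S
    by (meson S_closed subset_antisym subset_iff)
qed

lemma rep_iff:
  assumes "x \<in> S"
  shows "r \<in> R \<and> r \<in> orbit G \<phi> x \<longleftrightarrow> r = rep x"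
proof -
  have "\<exists>!r. r \<in> R \<inter> orbit G \<phi> x"
    by (rule R_unique) (use assms in \<open>auto simp: orbits_def\<close>)
  then show ?thesis unfolding rep_def by (metis (mono_tags, lifting) Int_iff theI')
qed

lemma rep_in_R: "x \<in> S \<Longrightarrow> rep x \<in> R"
  and rep_in_orbit: "x \<in> S \<Longrightarrow> rep x \<in> orbit G \<phi> x"
  using rep_iff by blast+

lemma rep_in_S [simp, intro]: "x \<in> S \<Longrightarrow> rep x \<in> S"
  using rep_in_R R_subset by blast

lemma rep_of_R: "r \<in> R \<Longrightarrow> rep r = r"
  using rep_iff R_subset orbit_refl by (metis S_closed subsetD)

lemma rep_eq_iff:
  assumes "r \<in> R" "x \<in> S"
  shows "rep x = r \<longleftrightarrow> x \<in> orbit G \<phi> r"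
  using assms rep_iff[OF assms(2), of r] orbit_sym R_subset by (metis S_closed subsetD)

lemma rep_act: "g \<in> carrier G \<Longrightarrow> x \<in> S \<Longrightarrow> rep (\<phi> g x) = rep x"
proof -
  assume g: "g \<in> carrier G" and x: "x \<in> S"
  have "\<phi> g x \<in> orbit G \<phi> x" using g by (auto simp: orbit_def)
  then show ?thesis unfolding rep_def using orbit_act x by simp
qed

lemma card_transporter:
  assumes x: "x \<in> S" and y: "y \<in> orbit G \<phi> x"
  shows "card {g \<in> carrier G. \<phi> g x = y} = card (stabilizer G \<phi> x)"
proof -
  obtain h where h: "h \<in> carrier G" "\<phi> h x = y" using y by (auto simp: orbit_def)
  have "bij_betw (\<lambda>g. h \<otimes> g) (stabilizer G \<phi> x) {g \<in> carrier G. \<phi> g x = y}"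
    by (rule bij_betw_byWitness[where f'="\<lambda>g. inv h \<otimes> g"])
      (use x h in \<open>auto simp: stabilizer_def act_comp simp flip: G.m_assoc\<close>)
  then show ?thesis by (simp add: bij_betw_same_card)
qed

text \<open>
  By \<open>norm_lincomb\<close>, the left-hand side is the coefficient at \<open>x\<close> of the norm of \<open>lincomb c\<close>. Each
  element of the orbit is reached from \<open>x\<close> by a coset of the stabilizer; this is where the
  stabilizers enter the Herbrand quotient.
\<close>

lemma sum_over_group:
  assumes "x \<in> S"
  shows "(\<Sum>g\<in>carrier G. c (\<phi> g x)) = int (card (stabilizer G \<phi> x)) * (\<Sum>y\<in>orbit G \<phi> x. c y)"
proof -
  have orb: "orbit G \<phi> x = (\<lambda>g. \<phi> g x) ` carrier G" by (auto simp: orbit_def)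
  have "(\<Sum>g\<in>carrier G. c (\<phi> g x))
      = (\<Sum>y\<in>orbit G \<phi> x. int (card {g \<in> carrier G. \<phi> g x = y}) * c y)"
    unfolding orb by (rule sum_fun_comp) (use finite_G in auto)
  also have "\<dots> = (\<Sum>y\<in>orbit G \<phi> x. int (card (stabilizer G \<phi> x)) * c y)"
    by (rule sum.cong) (simp_all add: card_transporter assms)
  finally show ?thesis by (simp add: sum_distrib_left)
qed

lemma card_stabilizer_pos: "x \<in> S \<Longrightarrow> 0 < card (stabilizer G \<phi> x)"
proof -
  assume "x \<in> S"
  then have "\<one> \<in> stabilizer G \<phi> x" by (simp add: stabilizer_def)
  moreover have "finite (stabilizer G \<phi> x)" using finite_G by (simp add: stabilizer_def)
  ultimately show ?thesis by (auto simp: card_gt_0_iff)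
qed

subsection \<open>Tate cohomology in degree 0\<close>

section \<open>Degree 0 for a permutation module\<close>

text \<open>
  A fixed element is an integral combination of orbit sums, and the norm of a basis element \<open>x\<close> is
  \<open>card (stabilizer G \<phi> x)\<close> times the sum of its orbit. Hence the norms are the fixed elements whose
  coefficient on each orbit is divisible by the stabilizer order. As a preimage one may take the
  element \<open>d\<close> concentrated on the representatives.
\<close>

lemma norm_of_lincomb_iff:
  assumes inv: "\<And>g x. g \<in> carrier G \<Longrightarrow> x \<in> S \<Longrightarrow> c (\<phi> g x) = c x"
  shows "lincomb c \<in> norm_map G A \<phi> ` B
    \<longleftrightarrow> (\<forall>r\<in>R. int (card (stabilizer G \<phi> r)) dvd c r)"
proof
  assume "lincomb c \<in> norm_map G A \<phi> ` B"
  then obtain d where "lincomb c = norm_map G A \<phi> (lincomb d)"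
    by (auto simp: B_eq_range_lincomb)
  then show "\<forall>r\<in>R. int (card (stabilizer G \<phi> r)) dvd c r"
    using R_subset by (auto simp: norm_lincomb lincomb_eq_iff sum_over_group)
next
  assume dvd: "\<forall>r\<in>R. int (card (stabilizer G \<phi> r)) dvd c r"
  define d where "d x = (if x \<in> R then c x div int (card (stabilizer G \<phi> x)) else 0)" for x
  have "(\<Sum>g\<in>carrier G. d (\<phi> g x)) = c x" if x: "x \<in> S" for x
  proof -
    let ?r = "rep x"
    have r: "?r \<in> R" "?r \<in> S" using x rep_in_R by auto
    obtain h where h: "h \<in> carrier G" "\<phi> h x = ?r"
      using rep_in_orbit[OF x] by (auto simp: orbit_def)
    \<comment> \<open>The sum depends only on the orbit, so it may be computed at the representative.\<close>
    have "(\<Sum>g\<in>carrier G. d (\<phi> g x)) = (\<Sum>g\<in>carrier G. d (\<phi> g ?r))"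
      by (rule sum.reindex_bij_witness[where i="\<lambda>g. g \<otimes> h" and j="\<lambda>g. g \<otimes> inv h"])
        (use h x in \<open>auto simp: act_comp G.m_assoc simp flip: h(2)\<close>)
    also have "\<dots> = int (card (stabilizer G \<phi> ?r)) * (\<Sum>y\<in>orbit G \<phi> ?r. d y)"
      by (rule sum_over_group) (use r in auto)
    also have "(\<Sum>y\<in>orbit G \<phi> ?r. d y) = (\<Sum>y\<in>{?r}. d y)"
    proof (rule sum.mono_neutral_right)
      show "finite (orbit G \<phi> ?r)"
        using orbit_subset_S[OF r(2)] finite_S finite_subset by blast
      show "{?r} \<subseteq> orbit G \<phi> ?r" using orbit_refl r by auto
      show "\<forall>y\<in>orbit G \<phi> ?r - {?r}. d y = 0"
        using rep_iff[OF r(2)] rep_of_R[OF r(1)] by (auto simp: d_def)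
    qed
    also have "int (card (stabilizer G \<phi> ?r)) * \<dots> = c ?r"
      using dvd r by (simp add: d_def)
    also have "c ?r = c x" using inv[OF h(1) x] h(2) by simp
    finally show ?thesis .
  qed
  then have "norm_map G A \<phi> (lincomb d) = lincomb c"
    by (simp add: norm_lincomb lincomb_eq_iff)
  then show "lincomb c \<in> norm_map G A \<phi> ` B"
    by (metis B_eq_range_lincomb image_eqI rangeI)
qed

text \<open>
  Reducing the coefficient at each representative modulo the stabilizer order separates the fixed
  elements modulo norms, and every family of residues occurs.
\<close>

lemma index_norms_in_fixed_points:
  "subgroup_index A {a \<in> B. \<forall>g\<in>carrier G. \<phi> g a = a} (norm_map G A \<phi> ` B)
    = (\<Prod>r\<in>R. card (stabilizer G \<phi> r))"
proof -
  let ?F = "{a \<in> B. \<forall>g\<in>carrier G. \<phi> g a = a}" and ?m = "\<lambda>r. int (card (stabilizer G \<phi> r))"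
  interpret N: group_hom A A "norm_map G A \<phi>" by unfold_locales (rule norm_hom)
  define coeff where "coeff a = (SOME c. a = lincomb c)" for a
  have coeff: "coeff (lincomb c) x = c x" if "x \<in> S" for c x
  proof -
    have "lincomb c = lincomb (coeff (lincomb c))"
      unfolding coeff_def by (rule someI[of "\<lambda>d. lincomb c = lincomb d"]) (rule refl)
    then have "\<forall>x\<in>S. c x = coeff (lincomb c) x" by (rule iffD1[OF lincomb_eq_iff])
    then have "c x = coeff (lincomb c) x" using that by (rule bspec)
    then show ?thesis by (rule sym)
  qed
  define \<psi> where "\<psi> a = (\<lambda>r\<in>R. coeff a r mod ?m r)" for a
  have \<psi>: "\<psi> (lincomb c) = (\<lambda>r\<in>R. c r mod ?m r)" for c
    using R_subset coeff by (auto simp: \<psi>_def intro!: restrict_ext)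
  have F: "a \<in> ?F \<longleftrightarrow>
      (\<exists>c. a = lincomb c \<and> (\<forall>g\<in>carrier G. \<forall>x\<in>S. c (\<phi> g x) = c x))" for a
    using fixed_lincomb_iff by (auto simp: B_eq_range_lincomb)
  have "subgroup_index A ?F (norm_map G A \<phi> ` B) = card (\<psi> ` ?F)"
  proof (rule A.subgroup_index_eq_card_image_iff)
    show "subgroup (norm_map G A \<phi> ` B) A" by (rule N.subgroup_img_is_subgroup[OF B_subgroup])
    show "?F \<subseteq> carrier A" using B_subgroup by (auto dest: subgroup.subset)
    fix a b assume "a \<in> ?F" "b \<in> ?F"
    then obtain c d where a: "a = lincomb c" "\<forall>g\<in>carrier G. \<forall>x\<in>S. c (\<phi> g x) = c x"
      and b: "b = lincomb d" "\<forall>g\<in>carrier G. \<forall>x\<in>S. d (\<phi> g x) = d x"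
      unfolding F by blast
    have "\<psi> a = \<psi> b \<longleftrightarrow> (\<forall>r\<in>R. c r mod ?m r = d r mod ?m r)"
      unfolding a b \<psi> by (metis (mono_tags, lifting) restrict_apply' restrict_ext)
    also have "\<dots> \<longleftrightarrow> lincomb (\<lambda>x. c x - d x) \<in> norm_map G A \<phi> ` B"
      using a b by (subst norm_of_lincomb_iff) (auto simp: mod_eq_dvd_iff)
    finally show "\<psi> a = \<psi> b \<longleftrightarrow> a \<otimes>\<^bsub>A\<^esub> inv\<^bsub>A\<^esub> b \<in> norm_map G A \<phi> ` B"
      by (simp add: a b lincomb_diff)
  qed
  also have "\<psi> ` ?F = (\<Pi>\<^sub>E r\<in>R. {0..<?m r})"
  proof (intro equalityI subsetI)
    fix t assume "t \<in> \<psi> ` ?F"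
    then show "t \<in> (\<Pi>\<^sub>E r\<in>R. {0..<?m r})"
      using R_subset card_stabilizer_pos by (auto simp: \<psi>_def)
  next
    fix t assume t: "t \<in> (\<Pi>\<^sub>E r\<in>R. {0..<?m r})"
    have invariant: "lincomb (\<lambda>x. t (rep x)) \<in> ?F"
      unfolding F by (rule exI[of _ "\<lambda>x. t (rep x)"]) (simp add: rep_act)
    have "\<psi> (lincomb (\<lambda>x. t (rep x))) = t"
    proof (rule PiE_ext)
      show "t \<in> (\<Pi>\<^sub>E r\<in>R. UNIV)" "\<psi> (lincomb (\<lambda>x. t (rep x))) \<in> (\<Pi>\<^sub>E r\<in>R. UNIV)"
        using t by (auto simp: \<psi>)
      fix r assume "r \<in> R"
      then show "\<psi> (lincomb (\<lambda>x. t (rep x))) r = t r"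
        using PiE_mem[OF t \<open>r \<in> R\<close>] by (simp add: \<psi> rep_of_R)
    qed
    then show "t \<in> \<psi> ` ?F" using invariant by (intro rev_image_eqI) (auto simp only:)
  qed
  also have "card \<dots> = (\<Prod>r\<in>R. card (stabilizer G \<phi> r))"
    using finite_subset[OF R_subset finite_S] by (simp add: card_PiE)
  finally show ?thesis .
qed

end

section \<open>Degree 1 for a cyclic permutation module\<close>

locale cyclic_permutation_module =
  cyclic_G_module G A \<phi> \<sigma> n + permutation_module G A \<phi> B S R
  for G (structure) and A and \<phi> and \<sigma> n B S R
begin

lemma partial_norm_B:
  assumes "a \<in> B"
  shows "partial_norm k a \<in> B"
  unfolding partial_norm_def
  by (rule A.finprod_in_subgroup[OF B_subgroup]) (use assms act_B in auto)

lemma gen_minus_one_B: "a \<in> B \<Longrightarrow> gen_minus_one a \<in> B"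
  using B_subgroup act_B unfolding gen_minus_one_def
  by (meson gen_closed subgroup.m_closed subgroup.m_inv_closed)

lemma norm_B: "a \<in> B \<Longrightarrow> norm_map G A \<phi> a \<in> B"
  using partial_norm_B norm_eq_partial_norm B_subgroup by (metis subgroup.mem_carrier)

text \<open>
  An element of trivial norm has coefficient sum \<open>0\<close> on every orbit, since that sum times the
  stabilizer order is a coefficient of the norm. It is therefore a combination of differences \<open>x - rep x\<close>, and each of these is
  \<open>(\<sigma>\<^sup>k - 1) (rep x)\<close> for some \<open>k\<close>, a multiple of \<open>\<sigma> - 1\<close>. By the description of \<open>H\<^sup>1\<close>
  in \<open>order_H1\<close>, the permutation module \<open>B\<close> thus has trivial first cohomology.
\<close>

lemma kernel_norm_eq_gen_minus_one_image:
  "{a \<in> B. norm_map G A \<phi> a = \<one>\<^bsub>A\<^esub>} = gen_minus_one ` B"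
proof (intro equalityI subsetI)
  fix a assume "a \<in> gen_minus_one ` B"
  then show "a \<in> {a \<in> B. norm_map G A \<phi> a = \<one>\<^bsub>A\<^esub>}"
    using gen_minus_one_B norm_gen_minus_one B_subgroup by (auto dest: subgroup.mem_carrier)
next
  fix a assume "a \<in> {a \<in> B. norm_map G A \<phi> a = \<one>\<^bsub>A\<^esub>}"
  then obtain c where a: "a = lincomb c" and "norm_map G A \<phi> (lincomb c) = \<one>\<^bsub>A\<^esub>"
    by (auto simp: B_eq_range_lincomb)
  then have "int (card (stabilizer G \<phi> x)) * (\<Sum>y\<in>orbit G \<phi> x. c y) = 0" if "x \<in> S" for x
    using that by (simp only: norm_lincomb lincomb_eq_one_iff sum_over_group[symmetric])
  then have orbit_sum: "(\<Sum>y\<in>orbit G \<phi> x. c y) = 0" if "x \<in> S" for x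
    using that card_stabilizer_pos[OF that] by fastforce
  interpret gen_minus_one: group_hom A A gen_minus_one by unfold_locales (rule gen_minus_one_hom)
  have "\<exists>u\<in>B. x = rep x \<otimes>\<^bsub>A\<^esub> gen_minus_one u" if x: "x \<in> S" for x
  proof -
    have "x \<in> orbit G \<phi> (rep x)" using rep_eq_iff rep_in_R x by blast
    then obtain k :: nat where "x = \<phi> (\<sigma> [^] k) (rep x)"
      by (auto simp: orbit_def carrier_eq_powers)
    moreover have "gen_minus_one (partial_norm k (rep x)) = \<phi> (\<sigma> [^] k) (rep x) \<otimes>\<^bsub>A\<^esub> inv\<^bsub>A\<^esub> (rep x)"
      by (rule gen_minus_one_partial_norm) (use x in auto)
    ultimately have "x = rep x \<otimes>\<^bsub>A\<^esub> gen_minus_one (partial_norm k (rep x))"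
      using x by (metis A.inv_solve_right' A.m_comm S_closed gen_minus_one_closed partial_norm_closed rep_in_S)
    moreover have "partial_norm k (rep x) \<in> B" using x S_subset_B by (intro partial_norm_B) auto
    ultimately show ?thesis by blast
  qed
  then obtain u where u: "u x \<in> B" "x = rep x \<otimes>\<^bsub>A\<^esub> gen_minus_one (u x)" if "x \<in> S" for x
    by metis
  have u_closed [simp]: "u x \<in> carrier A" if "x \<in> S" for x
    using u(1)[OF that] B_subgroup by (rule subgroup.mem_carrier[rotated])
  \<comment> \<open>In \<open>\<Prod> x\<^bsup>c x\<^esup>\<close>, replacing every \<open>x\<close> by its representative turns the exponents into orbit sums of \<open>c\<close>.\<close>
  have reps: "(\<Otimes>\<^bsub>A\<^esub>x\<in>S. rep x [^]\<^bsub>A\<^esub> c x) = \<one>\<^bsub>A\<^esub>"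
  proof -
    have "(\<Otimes>\<^bsub>A\<^esub>x\<in>S. rep x [^]\<^bsub>A\<^esub> c x) = (\<Otimes>\<^bsub>A\<^esub>x\<in>S. lincomb (\<lambda>y. if y = rep x then c x else 0))"
      by (rule A.finprod_cong') (auto simp: lincomb_single)
    also have "\<dots> = lincomb (\<lambda>y. \<Sum>x\<in>S. if y = rep x then c x else 0)"
      by (rule lincomb_sum[symmetric]) (rule finite_S)
    also have "\<dots> = \<one>\<^bsub>A\<^esub>"
      unfolding lincomb_eq_one_iff
    proof
      fix y assume y: "y \<in> S"
      show "(\<Sum>x\<in>S. if y = rep x then c x else 0) = 0"
      proof (cases "y \<in> R")
        case True
        have "(\<Sum>x\<in>S. if y = rep x then c x else 0) = (\<Sum>x\<in>{x \<in> S. y = rep x}. c x)"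
          by (rule sum.inter_filter[symmetric]) (rule finite_S)
        also have "{x \<in> S. y = rep x} = orbit G \<phi> y"
          using rep_eq_iff[OF True] orbit_subset_S[OF y] by auto
        finally show ?thesis using orbit_sum[OF y] by simp
      next
        case False
        then show ?thesis using rep_in_R by (intro sum.neutral) auto
      qed
    qed
    finally show ?thesis .
  qed
  have "a = (\<Otimes>\<^bsub>A\<^esub>x\<in>S. rep x [^]\<^bsub>A\<^esub> c x \<otimes>\<^bsub>A\<^esub> gen_minus_one (u x [^]\<^bsub>A\<^esub> c x))"
    unfolding a lincomb_def
  proof (rule A.finprod_cong')
    fix x assume x: "x \<in> S"
    have "x [^]\<^bsub>A\<^esub> c x = (rep x \<otimes>\<^bsub>A\<^esub> gen_minus_one (u x)) [^]\<^bsub>A\<^esub> c x"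
      using u(2)[OF x] by simp
    then show "x [^]\<^bsub>A\<^esub> c x = rep x [^]\<^bsub>A\<^esub> c x \<otimes>\<^bsub>A\<^esub> gen_minus_one (u x [^]\<^bsub>A\<^esub> c x)"
      using x by (simp add: A.int_pow_distrib gen_minus_one.hom_int_pow)
  qed auto
  also have "\<dots> = (\<Otimes>\<^bsub>A\<^esub>x\<in>S. rep x [^]\<^bsub>A\<^esub> c x) \<otimes>\<^bsub>A\<^esub> (\<Otimes>\<^bsub>A\<^esub>x\<in>S. gen_minus_one (u x [^]\<^bsub>A\<^esub> c x))"
    by (rule A.finprod_multf) auto
  also have "\<dots> = gen_minus_one (\<Otimes>\<^bsub>A\<^esub>x\<in>S. u x [^]\<^bsub>A\<^esub> c x)"
    by (subst A.hom_finprod[OF gen_minus_one_hom]) (auto simp: reps)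
  finally have "a = gen_minus_one (\<Otimes>\<^bsub>A\<^esub>x\<in>S. u x [^]\<^bsub>A\<^esub> c x)" .
  moreover have "(\<Otimes>\<^bsub>A\<^esub>x\<in>S. u x [^]\<^bsub>A\<^esub> c x) \<in> B"
    by (rule A.finprod_in_subgroup[OF B_subgroup])
      (use u(1) A.subgroup_int_pow_closed[OF B_subgroup] in auto)
  ultimately show "a \<in> gen_minus_one ` B" by blast
qed

section \<open>Modules containing a permutation module of finite index\<close>

lemma order_Tate_H0_eq_order_H1_times_stabilizers:
  assumes fin: "finite (rcosets\<^bsub>A\<^esub> B)"
  shows "order (Tate_H0 G A \<phi>) = order (H1 G A \<phi>) * (\<Prod>x\<in>R. card (stabilizer G \<phi> x))"
    and "order (H1 G A \<phi>) \<noteq> 0"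
proof -
  interpret gen_minus_one: group_hom A A gen_minus_one by unfold_locales (rule gen_minus_one_hom)
  have H1_B: "subgroup_index A {a \<in> B. norm_map G A \<phi> a = \<one>\<^bsub>A\<^esub>} (gen_minus_one ` B) = 1"
    unfolding kernel_norm_eq_gen_minus_one_image
    by (rule A.subgroup_index_self) (rule gen_minus_one.subgroup_img_is_subgroup[OF B_subgroup])
  have "{a \<in> B. gen_minus_one a = \<one>\<^bsub>A\<^esub>} = {a \<in> B. \<forall>g\<in>carrier G. \<phi> g a = a}"
    using gen_minus_one_eq_one_iff subgroup.mem_carrier[OF B_subgroup] by (intro Collect_cong) blast
  then have H0_B: "subgroup_index A {a \<in> B. gen_minus_one a = \<one>\<^bsub>A\<^esub>} (norm_map G A \<phi> ` B)
      = (\<Prod>x\<in>R. card (stabilizer G \<phi> x))"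
    using index_norms_in_fixed_points by simp
  note herbrand = A.herbrand_quotient_finite_index[OF gen_minus_one_hom norm_hom gen_minus_one_norm norm_gen_minus_one
      B_subgroup _ _ fin, folded order_H1 order_Tate_H0, unfolded H1_B H0_B]
  show "order (Tate_H0 G A \<phi>) = order (H1 G A \<phi>) * (\<Prod>x\<in>R. card (stabilizer G \<phi> x))"
    and "order (H1 G A \<phi>) \<noteq> 0"
    using herbrand gen_minus_one_B norm_B by auto
qed

end

theorem proposition1:
  fixes G :: "('g, 'm) monoid_scheme" and A :: "('a, 'n) monoid_scheme"
    and \<phi> :: "'g \<Rightarrow> 'a \<Rightarrow> 'a" and B S R :: "'a set"
  assumes "group G" and "finite (carrier G)" and "cyclic_group G"
    and "G_module G A \<phi>"
    and "G_submodule G A \<phi> B" and "finite (rcosets\<^bsub>A\<^esub> B)"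
    and "finite_Z_basis A B S"
    and "\<And>\<tau>. \<tau> \<in> carrier G \<Longrightarrow> \<phi> \<tau> ` S \<subseteq> S"
    \<comment> \<open>\<open>R\<close> is an arbitrary set of representatives of \<open>S/G\<close>\<close>
    and "R \<subseteq> S" and "\<And>Y. Y \<in> orbits G S \<phi> \<Longrightarrow> \<exists>!x. x \<in> R \<inter> Y"
  shows "herbrand_quotient G A \<phi> = of_nat (\<Prod>x\<in>R. card (stabilizer G \<phi> x))
    \<and> (of_nat (order (H1 G A \<phi>)) :: rat)
        = of_nat (card (rcosets\<^bsub>A\<lparr>carrier := fixed_points G A \<phi>\<rparr>\<^esub> (norm_image G A \<phi>)))
          / of_nat (\<Prod>x\<in>R. card (stabilizer G \<phi> x))"
proof -
  interpret G_module G A \<phi> by fact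
  obtain \<sigma> and n :: nat where "\<sigma> \<in> carrier G"
    and "bij_betw (\<lambda>i. \<sigma> [^]\<^bsub>G\<^esub> i) {..<n} (carrier G)" and "\<sigma> [^]\<^bsub>G\<^esub> n = \<one>\<^bsub>G\<^esub>"
    using G.finite_cyclic_group_powers assms(2,3) by metis
  then interpret cyclic_permutation_module G A \<phi> \<sigma> n B S R
    by unfold_locales (use assms in auto)
  define m where "m = (\<Prod>x\<in>R. card (stabilizer G \<phi> x))"
  have H0: "card (rcosets\<^bsub>A\<lparr>carrier := fixed_points G A \<phi>\<rparr>\<^esub> (norm_image G A \<phi>))
      = order (Tate_H0 G A \<phi>)"
    by (simp add: Tate_H0_def order_def FactGroup_def)
  have "card (stabilizer G \<phi> x) \<noteq> 0" if "x \<in> R" for x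
    using that R_subset card_stabilizer_pos[of x] by auto
  then have "m \<noteq> 0"
    unfolding m_def using finite_subset[OF R_subset finite_S] by simp
  moreover note order_Tate_H0_eq_order_H1_times_stabilizers[OF \<open>finite (rcosets\<^bsub>A\<^esub> B)\<close>, folded m_def]
  ultimately show ?thesis
    unfolding herbrand_quotient_def H0 m_def[symmetric] by simp
qed

end
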